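(* Let $L$ be a Latin square of order $n \geq 2$. Any partial transversal $T$ of $L$ of deficit $d$ is contained in an $(n+\lceil d/2 \rceil)$-cover. Moreover, if $T$ is maximal, then the smallest cover of $L$ containing $T$ has size $n+\lceil d/2 \rceil$.
   Context: A Latin square of order $n$ is an $n\times n$ array on $n$ symbols in which each symbol occurs once in each row and each column; its set of entries is $E(L)=\{(i,j,L_{ij})\}$. A line is the set of all entries in a given row, in a given column, or with a given symbol. A cover is a subset of $E(L)$ meeting every line; a $c$-cover is a cover of size $c$. A partial transversal of deficit $d$ is an $(n-d)$-subset of $E(L)$ in which every line is represented at most once; it is maximal if for every $\mathbf{e}\in E(L)\setminus T$, $T\cup\{\mathbf{e}\}$ is not a partial transversal. *)

theory Defs
  imports Complex_Main
begin

text \<open>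
  Rows and columns are indexed by \<open>{..<n}\<close>; the \<open>n\<close> symbols form an arbitrary set \<open>S\<close>.
  Values of \<open>L\<close> outside \<open>{..<n} \<times> {..<n}\<close> are irrelevant.
\<close>

definition latin_square :: "nat \<Rightarrow> 'a set \<Rightarrow> (nat \<Rightarrow> nat \<Rightarrow> 'a) \<Rightarrow> bool" where
  "latin_square n S L \<longleftrightarrow>
     finite S \<and> card S = n \<and>
     (\<forall>i<n. \<forall>j<n. L i j \<in> S) \<and>
     (\<forall>i<n. \<forall>s\<in>S. \<exists>!j. j < n \<and> L i j = s) \<and>
     (\<forall>j<n. \<forall>s\<in>S. \<exists>!i. i < n \<and> L i j = s)"

definition entries :: "nat \<Rightarrow> (nat \<Rightarrow> nat \<Rightarrow> 'a) \<Rightarrow> (nat \<times> nat \<times> 'a) set" where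
  "entries n L = {(i, j, L i j) | i j. i < n \<and> j < n}"

definition row_line :: "nat \<Rightarrow> (nat \<Rightarrow> nat \<Rightarrow> 'a) \<Rightarrow> nat \<Rightarrow> (nat \<times> nat \<times> 'a) set" where
  "row_line n L r = {(i, j, s) \<in> entries n L. i = r}"

definition column_line :: "nat \<Rightarrow> (nat \<Rightarrow> nat \<Rightarrow> 'a) \<Rightarrow> nat \<Rightarrow> (nat \<times> nat \<times> 'a) set" where
  "column_line n L c = {(i, j, s) \<in> entries n L. j = c}"

definition symbol_line :: "nat \<Rightarrow> (nat \<Rightarrow> nat \<Rightarrow> 'a) \<Rightarrow> 'a \<Rightarrow> (nat \<times> nat \<times> 'a) set" where
  "symbol_line n L x = {(i, j, s) \<in> entries n L. s = x}"

definition lines :: "nat \<Rightarrow> 'a set \<Rightarrow> (nat \<Rightarrow> nat \<Rightarrow> 'a) \<Rightarrow> (nat \<times> nat \<times> 'a) set set" where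
  "lines n S L = row_line n L ` {..<n} \<union> column_line n L ` {..<n} \<union> symbol_line n L ` S"

definition cover ::
    "nat \<Rightarrow> 'a set \<Rightarrow> (nat \<Rightarrow> nat \<Rightarrow> 'a) \<Rightarrow> (nat \<times> nat \<times> 'a) set \<Rightarrow> bool" where
  "cover n S L C \<longleftrightarrow> C \<subseteq> entries n L \<and> (\<forall>l\<in>lines n S L. C \<inter> l \<noteq> {})"

definition c_cover ::
    "nat \<Rightarrow> 'a set \<Rightarrow> (nat \<Rightarrow> nat \<Rightarrow> 'a) \<Rightarrow> nat \<Rightarrow> (nat \<times> nat \<times> 'a) set \<Rightarrow> bool" where
  "c_cover n S L c C \<longleftrightarrow> cover n S L C \<and> card C = c"

text \<open>
  The size condition \<open>card T = n - d\<close> is written additively, so that \<open>d \<le> n\<close> is implied and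
  truncated subtraction plays no role.
\<close>

definition partial_transversal ::
    "nat \<Rightarrow> 'a set \<Rightarrow> (nat \<Rightarrow> nat \<Rightarrow> 'a) \<Rightarrow> nat \<Rightarrow> (nat \<times> nat \<times> 'a) set \<Rightarrow> bool" where
  "partial_transversal n S L d T \<longleftrightarrow>
     T \<subseteq> entries n L \<and> card T + d = n \<and> (\<forall>l\<in>lines n S L. card (T \<inter> l) \<le> 1)"

text \<open>The enlarged set must fail to be a partial transversal of any deficit whatsoever.\<close>

definition maximal_partial_transversal ::
    "nat \<Rightarrow> 'a set \<Rightarrow> (nat \<Rightarrow> nat \<Rightarrow> 'a) \<Rightarrow> nat \<Rightarrow> (nat \<times> nat \<times> 'a) set \<Rightarrow> bool" where
  "maximal_partial_transversal n S L d T \<longleftrightarrow>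
     partial_transversal n S L d T \<and>
     (\<forall>e \<in> entries n L - T. \<not> (\<exists>d'. partial_transversal n S L d' (T \<union> {e})))"

end

theory Submission
  imports Defs
begin

text \<open>
  A partial transversal of deficit \<open>d\<close> misses exactly \<open>d\<close> rows, \<open>d\<close> columns and \<open>d\<close> symbols.
  Any two lines of different kinds meet, so two missed lines of each kind can be met by three
  entries; pairing off in this way meets all \<open>3 d\<close> missed lines with at most \<open>\<lceil>3 d / 2\<rceil>\<close> entries.
  If the transversal is maximal, no entry lies on three missed lines, so double counting shows that
  \<open>3 d / 2\<close> further entries are also necessary.
\<close>

abbreviation row :: "nat \<times> nat \<times> 'a \<Rightarrow> nat" where "row e \<equiv> fst e"
abbreviation col :: "nat \<times> nat \<times> 'a \<Rightarrow> nat" where "col e \<equiv> fst (snd e)"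
abbreviation symb :: "nat \<times> nat \<times> 'a \<Rightarrow> 'a" where "symb e \<equiv> snd (snd e)"

lemma entries_image: "entries n L = (\<lambda>(i, j). (i, j, L i j)) ` ({..<n} \<times> {..<n})"
  by (auto simp: entries_def)

lemma finite_entries: "finite (entries n L)"
  by (simp add: entries_image)

lemma card_entries: "card (entries n L) = n * n"
  unfolding entries_image by (subst card_image) (auto simp: inj_on_def)

lemma row_entries: "e \<in> entries n L \<Longrightarrow> row e \<in> {..<n}"
  and col_entries: "e \<in> entries n L \<Longrightarrow> col e \<in> {..<n}"
  and symb_entries: "latin_square n S L \<Longrightarrow> e \<in> entries n L \<Longrightarrow> symb e \<in> S"
  by (auto simp: entries_def latin_square_def)

lemma row_col_entry: "r < n \<Longrightarrow> c < n \<Longrightarrow> \<exists>e\<in>entries n L. row e = r \<and> col e = c"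
  by (force simp: entries_def)

lemma row_symb_entry:
  assumes "latin_square n S L" "r < n" "s \<in> S"
  shows "\<exists>e\<in>entries n L. row e = r \<and> symb e = s"
proof -
  obtain j where "j < n" "L r j = s" using assms unfolding latin_square_def by blast
  with \<open>r < n\<close> have "(r, j, s) \<in> entries n L" by (auto simp: entries_def)
  then show ?thesis by force
qed

lemma col_symb_entry:
  assumes "latin_square n S L" "c < n" "s \<in> S"
  shows "\<exists>e\<in>entries n L. col e = c \<and> symb e = s"
proof -
  obtain i where "i < n" "L i c = s" using assms unfolding latin_square_def by blast
  with \<open>c < n\<close> have "(i, c, s) \<in> entries n L" by (auto simp: entries_def)
  then show ?thesis by force
qed

text \<open>Each line is the fibre of a coordinate projection. In this form covering becomes
  surjectivity, and meeting every line at most once becomes injectivity, of \<open>row\<close>,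
  \<open>col\<close> and \<open>symb\<close>.\<close>

lemma ball_lines:
  "(\<forall>l\<in>lines n S L. P l) \<longleftrightarrow>
     (\<forall>r\<in>{..<n}. P {e \<in> entries n L. row e = r}) \<and>
     (\<forall>c\<in>{..<n}. P {e \<in> entries n L. col e = c}) \<and>
     (\<forall>s\<in>S. P {e \<in> entries n L. symb e = s})"
proof -
  have "row_line n L r = {e \<in> entries n L. row e = r}"
    "column_line n L c = {e \<in> entries n L. col e = c}"
    "symbol_line n L s = {e \<in> entries n L. symb e = s}" for r c s
    by (auto simp: row_line_def column_line_def symbol_line_def)
  then show ?thesis
    unfolding lines_def by (simp add: ball_Un)
qed

lemma cover_iff:
  "cover n S L C \<longleftrightarrow>
     C \<subseteq> entries n L \<and> {..<n} \<subseteq> row ` C \<and> {..<n} \<subseteq> col ` C \<and> S \<subseteq> symb ` C"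
proof -
  \<comment> \<open>The codomain is a type variable so that the fact serves rows and columns as well
    as symbols.\<close>
  have meet: "(\<forall>u\<in>U. C \<inter> {e \<in> entries n L. f e = u} \<noteq> {}) \<longleftrightarrow> U \<subseteq> f ` C"
    if "C \<subseteq> entries n L" for U :: "'c set" and f
  proof -
    have "C \<inter> {e \<in> entries n L. f e = u} \<noteq> {} \<longleftrightarrow> u \<in> f ` C" for u
      using that by auto
    then show ?thesis by blast
  qed
  show ?thesis
    unfolding cover_def ball_lines by (simp only: meet cong: conj_cong)
qed

text \<open>All nonempty fibres lie over \<open>U\<close>. Finiteness matters because
  \<open>card\<close> of an infinite fibre would be 0 and pass the bound.\<close>

lemma inj_on_iff_card_fibre_le_1:
  assumes "finite T" "f ` T \<subseteq> U"
  shows "inj_on f T \<longleftrightarrow> (\<forall>u\<in>U. card (T \<inter> {e. f e = u}) \<le> 1)"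
  using assms by (fastforce simp: card_le_Suc0_iff_eq inj_on_def)

text \<open>The Latin property enters by forcing all symbols into \<open>S\<close>; a repeated
  symbol outside \<open>S\<close> would lie on no line and go undetected.\<close>

lemma partial_transversal_iff:
  assumes "latin_square n S L"
  shows "partial_transversal n S L d T \<longleftrightarrow>
     T \<subseteq> entries n L \<and> card T + d = n \<and> inj_on row T \<and> inj_on col T \<and> inj_on symb T"
proof (cases "T \<subseteq> entries n L")
  case True
  have fin: "finite T" using True finite_entries finite_subset by blast
  have fibre: "T \<inter> {e \<in> entries n L. f e = u} = T \<inter> {e. f e = u}"
    for f :: "nat \<times> nat \<times> 'a \<Rightarrow> 'c" and u
    using True by blast
  have img: "row ` T \<subseteq> {..<n}" "col ` T \<subseteq> {..<n}" "symb ` T \<subseteq> S"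
    using True row_entries col_entries symb_entries[OF assms] by blast+
  show ?thesis
    unfolding partial_transversal_def ball_lines fibre
      inj_on_iff_card_fibre_le_1[OF fin img(1)] inj_on_iff_card_fibre_le_1[OF fin img(2)]
      inj_on_iff_card_fibre_le_1[OF fin img(3)] ..
qed (simp add: partial_transversal_def)

lemma card_missed:
  assumes "finite T" "inj_on f T" "f ` T \<subseteq> U" "card T + d = card U"
  shows "card (U - f ` T) = d"
  using assms by (simp add: card_Diff_subset card_image)

lemma card_missed_lines:
  assumes "latin_square n S L" "partial_transversal n S L d T"
  shows "card ({..<n} - row ` T) = d" "card ({..<n} - col ` T) = d" "card (S - symb ` T) = d"
proof -
  have T: "T \<subseteq> entries n L" "card T + d = n" "inj_on row T" "inj_on col T" "inj_on symb T"
    using assms partial_transversal_iff by blast+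
  have "finite T" using T(1) finite_entries finite_subset by blast
  moreover have "row ` T \<subseteq> {..<n}" "col ` T \<subseteq> {..<n}" "symb ` T \<subseteq> S"
    using T(1) row_entries col_entries symb_entries[OF assms(1)] by blast+
  moreover have "card S = n" using assms(1) by (simp add: latin_square_def)
  ultimately show "card ({..<n} - row ` T) = d" "card ({..<n} - col ` T) = d"
      "card (S - symb ` T) = d"
    using T by (auto intro!: card_missed)
qed

text \<open>Induction in steps of two, since removing two lines of each kind costs three entries and
  lowers the bound by exactly three. Only an upper bound on the size is needed, as the set is padded
  later.\<close>

lemma entries_meeting_lines:
  assumes "latin_square n S L"
    and "R \<subseteq> {..<n}" "card R = d" "C \<subseteq> {..<n}" "card C = d" "Y \<subseteq> S" "card Y = d"
  shows "\<exists>A \<subseteq> entries n L. card A \<le> (3 * d + 1) div 2 \<and>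
    R \<subseteq> row ` A \<and> C \<subseteq> col ` A \<and> Y \<subseteq> symb ` A"
  using assms(2-)
proof (induction d arbitrary: R C Y rule: induct_nat_012)
  case 0
  have "finite S" using assms(1) by (simp add: latin_square_def)
  with 0 have "R = {}" "C = {}" "Y = {}" by (metis card_0_eq finite_lessThan finite_subset)+
  then show ?case by (intro exI[of _ "{}"]) simp
next
  case 1
  \<comment> \<open>Three lines need two entries here: \<open>e1\<close> takes the row and the
    column, \<open>e2\<close> the symbol. This is where the bound rounds up.\<close>
  then obtain r c s where RCY: "R = {r}" "C = {c}" "Y = {s}"
    by (metis One_nat_def card_1_singletonE)
  with 1 obtain e1 e2 where "e1 \<in> entries n L" "row e1 = r" "col e1 = c"
      "e2 \<in> entries n L" "row e2 = r" "symb e2 = s"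
    using row_col_entry[of r n c L] row_symb_entry[OF assms(1), of r s] by auto
  with RCY show ?case
    by (intro exI[of _ "{e1, e2}"]) (auto simp: card_insert_if)
next
  case (ge2 d)
  obtain r1 r2 R' where R: "R = insert r1 (insert r2 R')" "card R' = d"
    using ge2.prems(2) by (metis card_Suc_eq)
  obtain c1 c2 C' where C: "C = insert c1 (insert c2 C')" "card C' = d"
    using ge2.prems(4) by (metis card_Suc_eq)
  obtain s1 s2 Y' where Y: "Y = insert s1 (insert s2 Y')" "card Y' = d"
    using ge2.prems(6) by (metis card_Suc_eq)
  have sub: "R' \<subseteq> {..<n}" "C' \<subseteq> {..<n}" "Y' \<subseteq> S"
    and in_lines: "r1 < n" "r2 < n" "c1 < n" "c2 < n" "s1 \<in> S" "s2 \<in> S"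
    using ge2.prems R C Y by auto
  obtain A where A: "A \<subseteq> entries n L" "card A \<le> (3 * d + 1) div 2"
      "R' \<subseteq> row ` A" "C' \<subseteq> col ` A" "Y' \<subseteq> symb ` A"
    using ge2.IH(1)[OF sub(1) R(2) sub(2) C(2) sub(3) Y(2)] by blast
  \<comment> \<open>The pairs row-column, row-symbol and column-symbol use each of the six removed
    lines once.\<close>
  obtain e1 e2 e3 where e: "e1 \<in> entries n L" "row e1 = r1" "col e1 = c1"
      "e2 \<in> entries n L" "row e2 = r2" "symb e2 = s1"
      "e3 \<in> entries n L" "col e3 = c2" "symb e3 = s2"
    using row_col_entry[of r1 n c1 L] row_symb_entry[OF assms(1), of r2 s1]
      col_symb_entry[OF assms(1), of c2 s2] in_lines by blast
  let ?A = "insert e1 (insert e2 (insert e3 A))"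
  have "finite A" using A(1) finite_entries finite_subset by blast
  then have "card ?A \<le> card A + 3" by (simp add: card_insert_if)
  also have "\<dots> \<le> (3 * Suc (Suc d) + 1) div 2" using A(2) by simp
  finally show ?case
    using e A R C Y by (intro exI[of _ ?A]) auto
qed

lemma cover_extending_card:
  assumes "n \<ge> 2" "latin_square n S L" "partial_transversal n S L d T"
  shows "\<exists>C. T \<subseteq> C \<and> c_cover n S L (n + (d + 1) div 2) C"
proof -
  have T: "T \<subseteq> entries n L" "card T + d = n"
    using assms(3) by (simp_all add: partial_transversal_def)
  obtain A where A: "A \<subseteq> entries n L" "card A \<le> (3 * d + 1) div 2"
      "{..<n} - row ` T \<subseteq> row ` A" "{..<n} - col ` T \<subseteq> col ` A" "S - symb ` T \<subseteq> symb ` A"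
    using entries_meeting_lines[OF assms(2) Diff_subset _ Diff_subset _ Diff_subset]
      card_missed_lines[OF assms(2,3)] by metis
  have "card (T \<union> A) \<le> card T + card A" by (rule card_Un_le)
  \<comment> \<open>Here \<open>card T\<close> is n - d, and (3d + 1) div 2 - d = (d + 1) div
    2.\<close>
  also have "\<dots> \<le> n + (d + 1) div 2" using A(2) T(2) by linarith
  finally have "card (T \<union> A) \<le> n + (d + 1) div 2" .
  \<comment> \<open>There are enough entries to pad \<open>T \<union> A\<close> to the exact size.
    This would fail for n = d = 1.\<close>
  moreover have "n + (d + 1) div 2 \<le> card (entries n L)"
  proof -
    have "n + (d + 1) div 2 \<le> 2 * n" using T(2) assms(1) by linarith
    also have "\<dots> \<le> n * n" using assms(1) by simp
    finally show ?thesis by (simp add: card_entries)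
  qed
  ultimately obtain C where C: "T \<union> A \<subseteq> C" "C \<subseteq> entries n L" "card C = n + (d + 1) div 2"
    using exists_subset_between[of "T \<union> A" "n + (d + 1) div 2" "entries n L"] T(1) A(1)
      finite_entries by blast
  moreover have "cover n S L C"
    unfolding cover_iff using A(3-5) C(1,2) by blast
  ultimately show ?thesis unfolding c_cover_def by blast
qed

text \<open>An entry on three missed lines could be added to \<open>T\<close>, giving a partial
  transversal of deficit d - 1.\<close>

lemma maximal_no_missed_entry:
  assumes "latin_square n S L" "maximal_partial_transversal n S L d T" "e \<in> entries n L"
  shows "row e \<in> row ` T \<or> col e \<in> col ` T \<or> symb e \<in> symb ` T"
proof (rule ccontr)
  assume missed: "\<not> ?thesis"
  have pt: "partial_transversal n S L d T"
    using assms(2) by (simp add: maximal_partial_transversal_def)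
  note T = pt[unfolded partial_transversal_iff[OF assms(1)]]
  have "finite T" using T finite_entries finite_subset by blast
  have "e \<notin> T" using missed by blast
  have "row e \<in> {..<n} - row ` T" using missed row_entries[OF assms(3)] by blast
  \<comment> \<open>The missed row of \<open>e\<close> rules out d = 0, where the truncated
    \<open>d - 1\<close> would give the wrong deficit.\<close>
  then have "d \<noteq> 0" using card_missed_lines(1)[OF assms(1) pt]
    by (metis card_0_eq empty_iff finite_Diff finite_lessThan)
  then have "partial_transversal n S L (d - 1) (T \<union> {e})"
    unfolding partial_transversal_iff[OF assms(1)]
    using T missed \<open>finite T\<close> \<open>e \<notin> T\<close> assms(3) by (auto simp: inj_on_insert)
  with \<open>e \<notin> T\<close> assms(2,3) show False
    by (auto simp: maximal_partial_transversal_def)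
qed

text \<open>Every element of \<open>V\<close> has a preimage that contributes 1. Written with
  \<open>of_bool\<close>, the counts for the three projections can be added entry by entry.\<close>

lemma card_le_sum_fibre:
  assumes "finite A" "V \<subseteq> f ` A"
  shows "card V \<le> (\<Sum>e\<in>A. of_bool (f e \<in> V))"
proof -
  have "V = f ` {e \<in> A. f e \<in> V}" using assms(2) by blast
  then have "card V \<le> card {e \<in> A. f e \<in> V}"
    by (metis assms(1) card_image_le finite_Collect_conjI Collect_mem_eq)
  also have "\<dots> = (\<Sum>e\<in>A. of_bool (f e \<in> V))"
    using assms(1) by (simp add: sum_of_bool_eq Int_def)
  finally show ?thesis .
qed

lemma maximal_cover_card_ge:
  assumes L: "latin_square n S L" and max: "maximal_partial_transversal n S L d T"
    and C: "cover n S L C" "T \<subseteq> C"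
  shows "n + (d + 1) div 2 \<le> card C"
proof -
  have pt: "partial_transversal n S L d T"
    using max by (simp add: maximal_partial_transversal_def)
  have sub: "C \<subseteq> entries n L" and fin: "finite C"
    using C(1) finite_entries finite_subset unfolding cover_iff by blast+
  let ?R = "{..<n} - row ` T" and ?K = "{..<n} - col ` T" and ?Y = "S - symb ` T"
  have missed: "?R \<subseteq> row ` (C - T)" "?K \<subseteq> col ` (C - T)" "?Y \<subseteq> symb ` (C - T)"
    using C(1) unfolding cover_iff by blast+
  have "3 * d = card ?R + card ?K + card ?Y"
    using card_missed_lines[OF L pt] by simp
  also have "\<dots> \<le> (\<Sum>e\<in>C - T. of_bool (row e \<in> ?R) + of_bool (col e \<in> ?K) + of_bool (symb e \<in> ?Y))"
    unfolding sum.distrib using fin missed by (intro add_mono card_le_sum_fibre) auto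
  also have "\<dots> \<le> (\<Sum>e\<in>C - T. 2)"
  proof (rule sum_mono)
    fix e assume "e \<in> C - T"
    then have "row e \<in> row ` T \<or> col e \<in> col ` T \<or> symb e \<in> symb ` T"
      using sub maximal_no_missed_entry[OF L max] by blast
    then show "of_bool (row e \<in> ?R) + of_bool (col e \<in> ?K) + of_bool (symb e \<in> ?Y) \<le> (2 :: nat)"
      by (auto simp only: of_bool_def DiffE split: if_split)
  qed
  also have "\<dots> = 2 * card (C - T)" by simp
  finally have "3 * d \<le> 2 * card (C - T)" .
  moreover have "card C = card T + card (C - T)"
    using C(2) fin by (metis card_Diff_subset card_mono finite_subset le_add_diff_inverse)
  moreover have "card T + d = n" using pt by (simp add: partial_transversal_def)
  \<comment> \<open>Integrality rounds 3d/2 up to (3d + 1) div 2, which matches the upper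
    bound.\<close>
  ultimately show ?thesis by linarith
qed

theorem theorem2p1:
  fixes n d :: nat and S :: "'a set" and L :: "nat \<Rightarrow> nat \<Rightarrow> 'a"
    and T :: "(nat \<times> nat \<times> 'a) set"
  assumes "n \<ge> 2"
    and "latin_square n S L"
    and "partial_transversal n S L d T"
  shows "(\<exists>C. T \<subseteq> C \<and> c_cover n S L (n + nat \<lceil>real d / 2\<rceil>) C) \<and>
    (maximal_partial_transversal n S L d T \<longrightarrow>
      (\<exists>C. is_arg_min card (\<lambda>C'. cover n S L C' \<and> T \<subseteq> C') C \<and>
           card C = n + nat \<lceil>real d / 2\<rceil>))"
proof -
  have "\<lceil>real d / 2\<rceil> = int ((d + 1) div 2)"
    by (rule ceiling_unique) linarith+
  then have half: "nat \<lceil>real d / 2\<rceil> = (d + 1) div 2" by simp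
  obtain C where C: "T \<subseteq> C" "cover n S L C" "card C = n + (d + 1) div 2"
    using cover_extending_card[OF assms] unfolding c_cover_def by blast
  \<comment> \<open>The lower bound holds for every cover containing \<open>T\<close>, so
    \<open>C\<close>, which attains it, is a minimiser.\<close>
  have "is_arg_min card (\<lambda>C'. cover n S L C' \<and> T \<subseteq> C') C"
    if "maximal_partial_transversal n S L d T"
    using C maximal_cover_card_ge[OF assms(2) that] by (auto simp: is_arg_min_def not_less)
  with C show ?thesis unfolding half c_cover_def by blast
qed

end
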